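(* Let $L$ be a compactly generated, reduced multiplicative lattice having more than two minimal prime elements. Then the zero-divisor graph $\Gamma^m(L)$ contains a cycle and $gr(\Gamma^m(L))=3$.
   Context: A multiplicative lattice is a complete lattice $L$ (least element $0$, greatest element $1$) with a binary operation $\cdot$ that is commutative and associative and satisfies, for all $a,b,b_\alpha\in L$: $a\cdot(\bigvee_\alpha b_\alpha)=\bigvee_\alpha (a\cdot b_\alpha)$, $a\cdot b\le a\wedge b$, and $a\cdot 1=a$. It is reduced if $a^n=0$ for some positive integer $n$ implies $a=0$. An element $c\in L$ is compact if $c\le\bigvee_\alpha a_\alpha$ implies $c\le\bigvee_{i=1}^n a_{\alpha_i}$ for some finite subfamily; $L$ is compactly generated if every element is a join of compact elements. An element $p\neq 1$ is prime if $a\cdot b\le p$ implies $a\le p$ or $b\le p$; a prime element is a minimal prime element if there is no prime element strictly below it. The graph $\Gamma^m(L)$ is the simple undirected graph with vertex set $\{x\in L: x\ne 0,\ x\cdot y=0 \text{ for some } y\neq 0 \text{ in } L\}$, in which two distinct vertices $a,b$ are adjacent iff $a\cdot b=0$. The girth $gr(G)$ of a graph $G$ is the length of its shortest cycle ($\infty$ if there is none). *)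

theory Defs
  imports "HOL-Library.Extended_Nat" "Graph_Theory.Pair_Digraph"
begin

section \<open>Multiplicative lattices\<close>

text \<open>
  The least element is \<open>bot\<close>. The greatest element is the unit of the multiplication, so it
  is identified with the monoid unit \<open>1\<close>; this makes powers available from the library.
  Commutativity, associativity and \<open>a * 1 = a\<close> come from \<^class>\<open>comm_monoid_mult\<close>.
\<close>

class multiplicative_lattice = complete_lattice + comm_monoid_mult +
  assumes one_eq_top: "1 = top"
    and mult_Sup: "a * Sup B = Sup ((\<lambda>b. a * b) ` B)"
    and mult_le_inf: "a * b \<le> inf a b"

definition reduced :: "'a::multiplicative_lattice itself \<Rightarrow> bool" where
  "reduced _ \<longleftrightarrow> (\<forall>a::'a. \<forall>n>0. a ^ n = bot \<longrightarrow> a = bot)"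

definition compact_element :: "'a::complete_lattice \<Rightarrow> bool" where
  "compact_element c \<longleftrightarrow> (\<forall>A. c \<le> Sup A \<longrightarrow> (\<exists>F. finite F \<and> F \<subseteq> A \<and> c \<le> Sup F))"

definition compactly_generated :: "'a::complete_lattice itself \<Rightarrow> bool" where
  "compactly_generated _ \<longleftrightarrow> (\<forall>x::'a. \<exists>C. (\<forall>c\<in>C. compact_element c) \<and> x = Sup C)"

definition prime_element :: "'a::multiplicative_lattice \<Rightarrow> bool" where
  "prime_element p \<longleftrightarrow> p \<noteq> 1 \<and> (\<forall>a b. a * b \<le> p \<longrightarrow> a \<le> p \<or> b \<le> p)"

definition minimal_prime_element :: "'a::multiplicative_lattice \<Rightarrow> bool" where
  "minimal_prime_element p \<longleftrightarrow> prime_element p \<and> \<not> (\<exists>q. prime_element q \<and> q < p)"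


section \<open>The zero-divisor graph\<close>

text \<open>
  An undirected simple graph is represented as a symmetric loop-free digraph without parallel
  arcs, possibly infinite: the locale \<^locale>\<open>pair_bidirected_digraph\<close>.
\<close>

definition zero_divisor_vertices :: "'a::multiplicative_lattice set" where
  "zero_divisor_vertices = {x. x \<noteq> bot \<and> (\<exists>y. y \<noteq> bot \<and> x * y = bot)}"

definition zero_divisor_graph :: "'a::multiplicative_lattice itself \<Rightarrow> 'a pair_pre_digraph" where
  "zero_divisor_graph _ =
    \<lparr> pverts = zero_divisor_vertices,
      parcs = {(a, b). a \<in> zero_divisor_vertices \<and> b \<in> zero_divisor_vertices
                       \<and> a \<noteq> b \<and> a * b = bot} \<rparr>"

lemma pair_bidirected_zero_divisor_graph:
  "pair_bidirected_digraph (zero_divisor_graph TYPE('a::multiplicative_lattice))"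
  by unfold_locales
    (auto simp: zero_divisor_graph_def symmetric_def sym_def mult.commute)


section \<open>Cycles and girth of undirected simple graphs\<close>

text \<open>
  In a symmetric digraph, \<^const>\<open>pre_digraph.cycle\<close> also accepts walks \<open>a, b, a\<close> that
  traverse one edge back and forth. These are not cycles of the undirected graph, and in a
  loop-free graph without parallel arcs they are excluded precisely by requiring length at least 3.
\<close>

definition undirected_cycle :: "'a pair_pre_digraph \<Rightarrow> ('a \<times> 'a) awalk \<Rightarrow> bool" where
  "undirected_cycle G p \<longleftrightarrow> pre_digraph.cycle (with_proj G) p \<and> 3 \<le> length p"

text \<open>The infimum of the empty set in \<^typ>\<open>enat\<close> is \<open>\<infinity>\<close>.\<close>

definition girth :: "'a pair_pre_digraph \<Rightarrow> enat" where
  "girth G = (INF p\<in>{p. undirected_cycle G p}. enat (length p))"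

end

theory Submission
  imports Defs
begin

text \<open>
  A triangle is a triple of nonzero elements with pairwise product \<open>0\<close>: in a reduced lattice such
  elements are automatically distinct, since \<open>a * a = 0\<close> forces \<open>a = 0\<close>. No undirected cycle is
  shorter than a triangle, so it suffices to show that a lattice without such a triple has at most
  two minimal primes.

  If there are no zero divisors, then \<open>0\<close> lies below every prime, and is itself prime unless
  \<open>0 = 1\<close>, so it is the only candidate for a minimal prime. Otherwise pick nonzero \<open>x, y\<close> with
  \<open>x * y = 0\<close>. The annihilator of \<open>x\<close> is prime: if \<open>a * b * x = 0\<close> with \<open>a * x\<close> and \<open>b * x\<close>
  nonzero, then \<open>a * x\<close>, \<open>b * x\<close>, \<open>y\<close> would be an orthogonal triple. The same holds for \<open>y\<close>.
  Moreover the product of the two annihilators is \<open>0\<close>, as otherwise it would form an orthogonal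
  triple with \<open>x\<close> and \<open>y\<close>. Hence every prime lies above one of these two primes, and a minimal
  prime must be one of them.
\<close>

lemma mult_bot_right [simp]: "a * bot = (bot :: 'a::multiplicative_lattice)"
  using mult_Sup[of a "{}"] by simp

lemma mult_bot_left [simp]: "bot * a = (bot :: 'a::multiplicative_lattice)"
  by (metis mult.commute mult_bot_right)

lemma mult_left_mono_lattice:
  fixes a b c :: "'a::multiplicative_lattice"
  assumes "a \<le> b"
  shows "c * a \<le> c * b"
proof -
  have "c * b = c * Sup {a, b}"
    using assms by (simp add: sup_absorb2)
  also have "\<dots> = sup (c * a) (c * b)"
    by (subst mult_Sup) simp
  finally show ?thesis
    by (metis sup_ge1)
qed

definition annihilator :: "'a::multiplicative_lattice \<Rightarrow> 'a" where
  "annihilator x = Sup {y. x * y = bot}"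

lemma mult_annihilator: "x * annihilator x = bot"
proof -
  have "x * annihilator x = Sup ((*) x ` {y. x * y = bot})"
    unfolding annihilator_def by (rule mult_Sup)
  also have "\<dots> \<le> bot"
    by (rule Sup_least) auto
  finally show ?thesis
    by (simp add: bot_unique)
qed

lemma le_annihilator_iff: "z \<le> annihilator x \<longleftrightarrow> x * z = bot"
proof
  assume "z \<le> annihilator x"
  then show "x * z = bot"
    by (metis bot_unique mult_annihilator mult_left_mono_lattice)
next
  assume "x * z = bot"
  then show "z \<le> annihilator x"
    unfolding annihilator_def by (simp add: Sup_upper)
qed

definition orthogonal_triple :: "'a::multiplicative_lattice \<Rightarrow> 'a \<Rightarrow> 'a \<Rightarrow> bool" where
  "orthogonal_triple a b c \<longleftrightarrow> a \<noteq> bot \<and> b \<noteq> bot \<and> c \<noteq> bot \<and> a * b = bot \<and> b * c = bot \<and> c * a = bot"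

text \<open>
  The element \<open>y\<close> serves as the third member of a triple whose other two members
  are multiples of \<open>x\<close>.
\<close>

lemma prime_annihilator:
  fixes x y :: "'a::multiplicative_lattice"
  assumes no_triple: "\<And>a b c::'a. \<not> orthogonal_triple a b c"
    and "x \<noteq> bot" "y \<noteq> bot" "x * y = bot"
  shows "prime_element (annihilator x)"
  unfolding prime_element_def
proof (intro conjI allI impI)
  show "annihilator x \<noteq> 1"
    using \<open>x \<noteq> bot\<close> mult_annihilator[of x] by auto
next
  fix a b
  assume "a * b \<le> annihilator x"
  then have abx: "x * (a * b) = bot"
    by (simp add: le_annihilator_iff)
  have "(x * a) * (x * b) = x * (x * (a * b))"
    by (simp add: mult_ac)
  then have "(x * a) * (x * b) = bot"
    by (simp add: abx)
  moreover have "(x * b) * y = b * (x * y)" "y * (x * a) = a * (x * y)"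
    by (simp_all add: mult_ac)
  ultimately have "x * a = bot \<or> x * b = bot"
    using no_triple[of "x * a" "x * b" y] assms(3,4) by (auto simp: orthogonal_triple_def)
  then show "a \<le> annihilator x \<or> b \<le> annihilator x"
    by (simp add: le_annihilator_iff)
qed

lemma minimal_prime_element_eq:
  assumes "minimal_prime_element r" "prime_element p" "p \<le> r"
  shows "r = p"
  using assms unfolding minimal_prime_element_def by (auto simp: order_less_le)

text \<open>
  Two primes \<open>p\<close>, \<open>q\<close> with \<open>p * q = 0\<close> are the only candidates for minimal primes; without zero
  divisors, \<open>p = q = 0\<close> is a degenerate such pair.
\<close>

lemma minimal_primes_subset_pair:
  assumes no_triple: "\<And>a b c::'a::multiplicative_lattice. \<not> orthogonal_triple a b c"
  shows "\<exists>p q::'a. {r. minimal_prime_element r} \<subseteq> {p, q}"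
proof (cases "\<exists>x y::'a. x \<noteq> bot \<and> y \<noteq> bot \<and> x * y = bot")
  case True
  then obtain x y :: 'a where xy: "x \<noteq> bot" "y \<noteq> bot" "x * y = bot"
    by blast
  let ?p = "annihilator x" and ?q = "annihilator y"
  have primes: "prime_element ?p" "prime_element ?q"
    using prime_annihilator[OF no_triple] xy by (metis mult.commute)+
  have "y * (?p * ?q) = ?p * (y * ?q)" "(?p * ?q) * x = ?q * (x * ?p)"
    by (simp_all add: mult_ac)
  then have pq: "?p * ?q = bot"
    using no_triple[of x y "?p * ?q"] xy by (auto simp: orthogonal_triple_def mult_annihilator)
  have "r = ?p \<or> r = ?q" if r: "minimal_prime_element r" for r
  proof -
    have "?p \<le> r \<or> ?q \<le> r"
      using r pq unfolding minimal_prime_element_def prime_element_def by (metis bot_least)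
    then show ?thesis
      using minimal_prime_element_eq[OF r] primes by blast
  qed
  then show ?thesis
    by blast
next
  case False
  have "r = bot" if r: "minimal_prime_element r" for r :: 'a
  proof -
    have "(1::'a) \<noteq> bot"
      using r unfolding minimal_prime_element_def prime_element_def
      by (metis bot_least bot_unique one_eq_top top_greatest antisym)
    then have "prime_element (bot::'a)"
      using False by (auto simp: prime_element_def bot_unique)
    then show ?thesis
      using minimal_prime_element_eq[OF r] by simp
  qed
  then show ?thesis
    by blast
qed

lemma ex_orthogonal_triple:
  assumes "infinite {p::'a::multiplicative_lattice. minimal_prime_element p}
    \<or> card {p::'a. minimal_prime_element p} > 2"
  shows "\<exists>a b c::'a. orthogonal_triple a b c"
proof (rule ccontr)
  assume "\<not> ?thesis"
  then obtain p q :: 'a where sub: "{r. minimal_prime_element r} \<subseteq> {p, q}"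
    using minimal_primes_subset_pair by blast
  have "card {r::'a. minimal_prime_element r} \<le> card {p, q}"
    using sub by (intro card_mono) auto
  moreover have "card {p, q} \<le> 2"
    by (simp add: card_insert_if)
  ultimately show False
    using assms finite_subset[OF sub] by auto
qed

lemma reduced_square_ne_bot:
  fixes a :: "'a::multiplicative_lattice"
  assumes "reduced TYPE('a)" "a \<noteq> bot"
  shows "a * a \<noteq> bot"
  using assms unfolding reduced_def by (metis power2_eq_square pos2)

lemma triangle_of_orthogonal_triple:
  fixes a b c :: "'a::multiplicative_lattice"
  assumes red: "reduced TYPE('a)" and abc: "orthogonal_triple a b c"
  shows "undirected_cycle (zero_divisor_graph TYPE('a)) [(a, b), (b, c), (c, a)]"
proof -
  let ?G = "zero_divisor_graph TYPE('a)"
  interpret pair_bidirected_digraph ?G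
    by (rule pair_bidirected_zero_divisor_graph)
  have ne: "a \<noteq> b" "b \<noteq> c" "c \<noteq> a"
    using reduced_square_ne_bot[OF red] abc by (auto simp: orthogonal_triple_def)
  have verts: "a \<in> zero_divisor_vertices" "b \<in> zero_divisor_vertices" "c \<in> zero_divisor_vertices"
    using abc unfolding zero_divisor_vertices_def orthogonal_triple_def by auto
  have "awalk a [(a, b), (b, c), (c, a)] a"
    unfolding awalk_Cons_iff awalk_Nil_iff
    using ne verts abc
    by (simp add: zero_divisor_graph_def orthogonal_triple_def)
  then have "cycle [(a, b), (b, c), (c, a)]"
    using ne by (auto simp: cycle_def)
  then show ?thesis
    by (simp add: undirected_cycle_def)
qed

lemma girth_eq_3_if_triangle:
  assumes "undirected_cycle G p" "length p = 3"
  shows "girth G = 3"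
proof (rule antisym)
  have "girth G \<le> enat (length p)"
    unfolding girth_def using assms(1) by (intro INF_lower) simp
  then show "girth G \<le> 3"
    using assms(2) by (simp add: numeral_eq_enat)
  show "3 \<le> girth G"
    unfolding girth_def
    by (rule INF_greatest) (auto simp: undirected_cycle_def numeral_eq_enat)
qed

theorem theorem2p18:
  assumes "compactly_generated TYPE('a::multiplicative_lattice)"
    and "reduced TYPE('a)"
    and "infinite {p::'a. minimal_prime_element p} \<or> card {p::'a. minimal_prime_element p} > 2"
  shows "(\<exists>p. undirected_cycle (zero_divisor_graph TYPE('a)) p) \<and>
         girth (zero_divisor_graph TYPE('a)) = 3"
proof -
  obtain a b c :: 'a where "orthogonal_triple a b c"
    using ex_orthogonal_triple[OF assms(3)] by blast
  then have "undirected_cycle (zero_divisor_graph TYPE('a)) [(a, b), (b, c), (c, a)]"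
    by (rule triangle_of_orthogonal_triple[OF assms(2)])
  then show ?thesis
    using girth_eq_3_if_triangle by fastforce
qed

end
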